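(* Let $r\ge 1$ and let $\mathbf a=(a_1,\ldots,a_r)$ be a sequence of positive integers. Let $\zeta_{\mathbf a}(s)=\sum_{n\ge 1}p_{\mathbf a}(n)n^{-s}$, continued meromorphically to $\mathbb C$, and let $R_m=\mathrm{Res}_{s=m}\,\zeta_{\mathbf a}(s)$. For $1\leq m \leq r$ we have $$R_m = \frac{(-1)^{r-m}}{(m-1)!\,(r-m)!}\,B_{r-m}(a_1,\ldots,a_r).$$
   Context: $p_{\mathbf a}(n)$ (the restricted partition function) is the number of integer solutions $(x_1,\ldots,x_r)$ of $\sum_{i=1}^r a_ix_i=n$ with all $x_i\ge 0$. The Dirichlet series $\zeta_{\mathbf a}(s)$ converges for $\mathrm{Re}(s)>r$ and extends to a meromorphic function on $\mathbb C$ whose poles lie in $\{1,\ldots,r\}$ and are simple (the residue at a regular point is $0$). The Bernoulli–Barnes numbers $B_j(a_1,\ldots,a_r)$ are defined by $$ \frac{z^r}{(e^{a_1z}-1)\cdots (e^{a_rz}-1)} = \sum_{j=0}^{\infty}B_j(a_1,\ldots,a_r) \frac{z^j}{j!}. $$ *)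

theory Defs
  imports
    "HOL-Complex_Analysis.Complex_Analysis"
    "HOL-Computational_Algebra.Formal_Power_Series"
begin

definition restricted_partition :: "nat list \<Rightarrow> nat \<Rightarrow> nat" where
  "restricted_partition a n =
     card {x :: nat list. length x = length a \<and> (\<Sum>i<length a. a ! i * x ! i) = n}"

text \<open>
  The term with index \<open>n\<close> of the series below is the Dirichlet coefficient at \<open>n + 1\<close>.
  Being nicely meromorphic fixes the values of the continuation at its singularities
  (removable ones are filled in, poles get the value \<open>0\<close>), so at most one function satisfies
  the predicate.
\<close>

definition is_barnes_zeta :: "nat list \<Rightarrow> (complex \<Rightarrow> complex) \<Rightarrow> bool" where
  "is_barnes_zeta a Z \<longleftrightarrow>
     Z nicely_meromorphic_on UNIV \<and>
     (\<forall>s. Re s > real (length a) \<longrightarrow>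
        (\<lambda>n. of_nat (restricted_partition a (Suc n)) * of_nat (Suc n) powr (- s)) sums Z s)"

definition barnes_zeta :: "nat list \<Rightarrow> complex \<Rightarrow> complex" where
  "barnes_zeta a = (SOME Z. is_barnes_zeta a Z)"

text \<open>
  For positive entries of \<open>a\<close>, numerator and denominator below both have subdegree
  \<open>length a\<close>, so the division of formal power series is exact.
\<close>

definition bernoulli_barnes :: "nat list \<Rightarrow> nat \<Rightarrow> complex" where
  "bernoulli_barnes a j =
     fact j * fps_nth (fps_X ^ length a / (\<Prod>i<length a. (fps_exp (of_nat (a ! i)) - 1))) j"

lemma bernoulli_barnes_generating_function:
  assumes "\<forall>i<length a. a ! i > 0"
  shows "(\<Prod>i<length a. (fps_exp (of_nat (a ! i)) - 1)) * Abs_fps (\<lambda>j. bernoulli_barnes a j / fact j)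
           = fps_X ^ length a"
proof -
  let ?D = "\<Prod>i<length a. fps_exp (of_nat (a ! i)) - 1 :: complex fps"
  have sub: "subdegree (fps_exp (of_nat k) - 1 :: complex fps) = 1" if "k > 0" for k :: nat
    by (rule subdegreeI) (use that in auto)
  have nz: "fps_exp (of_nat (a ! i)) - 1 \<noteq> (0 :: complex fps)" if "i < length a" for i
    using sub[of "a ! i"] assms that by force
  have "subdegree ?D = (\<Sum>i<length a. subdegree (fps_exp (of_nat (a ! i)) - 1 :: complex fps))"
    by (rule subdegree_prod) (use nz in auto)
  also have "\<dots> = length a"
    using assms sub by simp
  finally have sD: "subdegree ?D = length a" .
  have D0: "?D \<noteq> 0"
    using nz by simp
  have "?D dvd fps_X ^ length a"
    using D0 sD by (subst fps_dvd_iff) (auto simp: fps_X_power_subdegree)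
  then have "?D * (fps_X ^ length a / ?D) = fps_X ^ length a"
    by simp
  moreover have "Abs_fps (\<lambda>j. bernoulli_barnes a j / fact j) = fps_X ^ length a / ?D"
    by (rule fps_ext) (simp add: bernoulli_barnes_def)
  ultimately show ?thesis
    by simp
qed

end

theory Submission
  imports Defs
begin

text \<open>
  The proof is Riemann's Mellin transform argument. Write \<open>p\<close> for the restricted partition
  function of \<open>a\<close> and, for \<open>t > 0\<close>, \<open>F(t) = (\<Sum>n. p(n) exp(-nt)) = (\<Prod>i. 1 / (1 - exp(-a\<^sub>i t)))\<close>.
  Integrating \<open>F - 1\<close> term by term against \<open>t powr (s - 1)\<close> gives, for \<open>Re s > r\<close>,
  \<open>Gamma(s) \<zeta>(s) = (\<integral>t>0. t powr (s - 1) (F(t) - 1))\<close>.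

  Substituting \<open>z = -t\<close> in the generating function of the Bernoulli--Barnes numbers shows that
  \<open>t^r F(t) = (\<Sum>j. c\<^sub>j t^j)\<close> with \<open>c\<^sub>j = (-1)^j B\<^sub>j / j!\<close> for all small \<open>t > 0\<close>. Choose \<open>d > 0\<close>
  strictly inside the disc of convergence and cut the integral at \<open>d\<close>. The part over \<open>t > d\<close> is
  entire in \<open>s\<close>, because \<open>F - 1\<close> decays faster than every power of \<open>t\<close>. The part over \<open>0 < t \<le> d\<close>
  is the series \<open>\<Sum>j. c\<^sub>j d powr (s - r + j) / (s - r + j)\<close> (minus the contribution \<open>d powr s / s\<close>
  of the constant \<open>1\<close>, which amounts to lowering \<open>c\<^sub>r\<close> by one). Since \<open>\<Sum>j. \<bar>c\<^sub>j\<bar> d^j\<close> converges,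
  this is a meromorphic function on the whole plane whose only singularities are the simple poles
  \<open>s = r - j\<close>, with residues \<open>c\<^sub>j\<close>. Cutting inside the disc of convergence, rather than at \<open>1\<close>, is
  what yields the continuation to the whole plane in one stroke.

  Multiplication by the entire function \<open>1 / Gamma\<close> produces \<open>\<zeta>\<close>, with residue \<open>c\<^bsub>r-m\<^esub> / Gamma(m)\<close>
  at \<open>s = m\<close>. This is \<open>dirichlet_series_continuation\<close>, stated for an arbitrary Dirichlet series
  with nonnegative coefficients whose exponential series has such an expansion at \<open>0\<close>. The
  identity theorem finally makes the residues independent of the continuation chosen.
\<close>

section \<open>Integrals against powers\<close>

text \<open>
  The library's theorem on integrating a series term by term, transported from the restricted
  measure to set integrals.
\<close>

lemma set_sums_integral:
  fixes f :: "nat \<Rightarrow> real \<Rightarrow> complex"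
  assumes A: "A \<in> sets lborel"
    and int: "\<And>n. set_integrable lborel A (f n)"
    and summ: "\<And>x. x \<in> A \<Longrightarrow> summable (\<lambda>n. norm (f n x))"
    and sumi: "summable (\<lambda>n. LINT x:A|lborel. norm (f n x))"
  shows "set_integrable lborel A (\<lambda>x. \<Sum>n. f n x)"
    and "(\<lambda>n. LINT x:A|lborel. f n x) sums (LINT x:A|lborel. (\<Sum>n. f n x))"
proof -
  let ?M = "restrict_space lborel A"
  have A': "A \<inter> space lborel \<in> sets lborel" using A by simp
  have 1: "integrable ?M (f n)" for n
    using int[of n] A by (simp add: set_integrable_def integrable_restrict_space)
  have 2: "AE x in ?M. summable (\<lambda>i. norm (f i x))"
    by (rule AE_I2) (use summ in \<open>auto simp: space_restrict_space\<close>)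
  have 3: "summable (\<lambda>i. \<integral>x. norm (f i x) \<partial>?M)"
    using sumi A by (simp add: set_lebesgue_integral_def integral_restrict_space)
  show "set_integrable lborel A (\<lambda>x. \<Sum>n. f n x)"
    using integrable_suminf[OF 1 2 3] A by (simp add: set_integrable_def integrable_restrict_space)
  show "(\<lambda>n. LINT x:A|lborel. f n x) sums (LINT x:A|lborel. (\<Sum>n. f n x))"
    using sums_integral[OF 1 2 3] A by (simp add: set_lebesgue_integral_def integral_restrict_space)
qed

text \<open>
  Substitute \<open>a t\<close> for \<open>t\<close> in Euler's integral. With \<open>a = n\<close> this turns the term \<open>exp (- n t)\<close> of
  an exponential series into the term \<open>n powr (- s)\<close> of a Dirichlet series.
\<close>

lemma Gamma_integral_scaled:
  fixes a :: real and s :: complex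
  assumes "a > 0" "Re s > 0"
  shows "set_integrable lborel {0<..} (\<lambda>t. of_real t powr (s - 1) * of_real (exp (- (a * t))))"
    and "(LINT t:{0<..}|lborel. of_real t powr (s - 1) * of_real (exp (- (a * t))))
        = Gamma s * of_real a powr (- s)"
proof -
  define f where "f a t = complex_of_real t powr (s - 1) * of_real (exp (- (a * t)))" for a t :: real
  have meas: "set_borel_measurable lborel {0<..} (f a)" for a
    unfolding set_borel_measurable_def f_def by measurable
  have f1: "f a t = complex_of_real t powr (s - 1) / of_real (exp (a * t))" for a t
    by (simp add: f_def exp_minus field_simps)
  have int: "set_integrable lborel {0<..} (f a)" if "a > 0" for a
    using absolutely_integrable_Gamma_integral[OF assms(2) that] meas[of a]
    by (simp add: f1[abs_def] set_integrable_def set_borel_measurable_def integrable_completion)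
  show "set_integrable lborel {0<..} (\<lambda>t. of_real t powr (s - 1) * of_real (exp (- (a * t))))"
    using int[OF assms(1)] unfolding f_def[abs_def] .
  have "Gamma s = (LINT t:{0<..}|lborel. f 1 t)"
    using Gamma_integral_complex'[OF assms(2)] set_borel_integral_eq_integral(2)[OF int[of 1]]
    unfolding f1[abs_def] by (simp add: integral_unique)
  also have "\<dots> = a *\<^sub>R (\<integral>t. indicator {0<..} (a * t) *\<^sub>R f 1 (a * t) \<partial>lborel)"
    unfolding set_lebesgue_integral_def
    by (subst lborel_integral_real_affine[of a _ 0]) (use assms in auto)
  also have "(\<lambda>t. indicator {0<..} (a * t) *\<^sub>R f 1 (a * t)) =
             (\<lambda>t. of_real a powr (s - 1) * (indicator {0<..} t *\<^sub>R f a t))"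
    using assms by (auto simp: fun_eq_iff f_def indicator_def zero_less_mult_iff powr_times_real)
  also have "(\<integral>t. of_real a powr (s - 1) * (indicator {0<..} t *\<^sub>R f a t) \<partial>lborel)
               = of_real a powr (s - 1) * (LINT t:{0<..}|lborel. f a t)"
    unfolding set_lebesgue_integral_def by (rule integral_mult_right_zero)
  finally have "Gamma s = of_real a powr s * (LINT t:{0<..}|lborel. f a t)"
    using assms by (simp add: powr_diff scaleR_conv_of_real)
  then show "(LINT t:{0<..}|lborel. of_real t powr (s - 1) * of_real (exp (- (a * t))))
      = Gamma s * of_real a powr (- s)"
    using assms by (simp add: f_def powr_minus)
qed

lemma norm_of_real_powr: "t > 0 \<Longrightarrow> norm (complex_of_real t powr z) = t powr Re z"
  by (simp add: norm_powr_real_powr)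

lemma set_integral_norm_powr_exp:
  fixes a :: real and s :: complex
  assumes "a > 0" "Re s > 0"
  shows "(LINT t:{0<..}|lborel. norm (of_real t powr (s - 1) * complex_of_real (exp (- (a * t)))))
      = Gamma (Re s) * a powr (- Re s)"
proof -
  have "complex_of_real (LINT t:{0<..}|lborel. norm (of_real t powr (s - 1) * complex_of_real (exp (- (a * t)))))
     = (LINT t:{0<..}|lborel. of_real (norm (of_real t powr (s - 1) * complex_of_real (exp (- (a * t))))))"
    by (simp add: set_integral_complex_of_real)
  also have "\<dots> = (LINT t:{0<..}|lborel. of_real t powr (of_real (Re s) - 1) * complex_of_real (exp (- (a * t))))"
    by (rule set_lebesgue_integral_cong)
        (auto simp: norm_mult norm_of_real_powr powr_of_real[symmetric])
  also have "\<dots> = of_real (Gamma (Re s) * a powr (- Re s))"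
    using assms by (subst Gamma_integral_scaled)
        (auto simp: Gamma_complex_of_real powr_of_real[symmetric])
  finally show ?thesis by (simp only: of_real_eq_iff)
qed

text \<open>
  Only \<open>Re w > 0\<close> is required, so the integrand may be unbounded near \<open>0\<close>; the antiderivative
  \<open>t powr w / w\<close> still extends continuously by \<open>0\<close>, and for the absolute integrability the same
  computation with \<open>Re w\<close> in place of \<open>w\<close> bounds the norm.
\<close>

lemma powr_integral_from_0:
  fixes d :: real and w :: complex
  assumes "d > 0" "Re w > 0"
  shows "set_integrable lborel {0<..d} (\<lambda>t. of_real t powr (w - 1))"
    and "(LINT t:{0<..d}|lborel. of_real t powr (w - 1)) = of_real d powr w / w"
proof -
  have hi: "((\<lambda>t. complex_of_real t powr (z - 1))
      has_integral (of_real d powr z / z - of_real 0 powr z / z)) {0..d}"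
    if "Re z > 0" for z using that assms
      by (intro fundamental_theorem_of_calculus_interior)
         (auto intro!: continuous_intros derivative_eq_intros has_vector_derivative_real_field)
  have hi': "((\<lambda>t. complex_of_real t powr (z - 1)) has_integral of_real d powr z / z) {0<..d}"
      if "Re z > 0" for z
  proof -
    have "((\<lambda>t. complex_of_real t powr (z - 1)) has_integral of_real d powr z / z) {0..d}"
      using hi[OF that] that by auto
    then have "((\<lambda>t. if t \<in> {0<..d} then complex_of_real t powr (z - 1) else 0)
        has_integral of_real d powr z / z) {0..d}"
      by (rule has_integral_spike[of "{0}", rotated 2]) auto
    then show ?thesis by (subst (asm) has_integral_restrict) auto
  qed
  have re: "((\<lambda>t. t powr (Re w - 1))
      has_integral Re (of_real d powr of_real (Re w) / of_real (Re w))) {0<..d}"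
  proof -
    have "((\<lambda>t. Re (complex_of_real t powr (of_real (Re w) - 1)))
        has_integral Re (of_real d powr of_real (Re w) / of_real (Re w))) {0<..d}"
      using has_integral_linear[OF hi'[of "of_real (Re w)"] bounded_linear_Re] assms
          by (simp add: o_def)
    then show ?thesis
      by (rule has_integral_eq[rotated]) (use powr_of_real[of _ "Re w - 1"] in auto)
  qed
  have "(\<lambda>t. complex_of_real t powr (w - 1)) absolutely_integrable_on {0<..d}"
  proof (rule absolutely_integrable_integrable_bound)
    show "(\<lambda>t. complex_of_real t powr (w - 1)) integrable_on {0<..d}" using hi'[OF assms(2)] by blast
    show "(\<lambda>t. t powr (Re w - 1)) integrable_on {0<..d}" using re by blast
  qed (auto simp: norm_of_real_powr)
  moreover have "set_borel_measurable lborel {0<..d} (\<lambda>t. of_real t powr (w - 1) :: complex)"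
    unfolding set_borel_measurable_def by measurable
  ultimately show 1: "set_integrable lborel {0<..d} (\<lambda>t. of_real t powr (w - 1))"
    by (simp add: set_integrable_def set_borel_measurable_def integrable_completion)
  show "(LINT t:{0<..d}|lborel. of_real t powr (w - 1)) = of_real d powr w / w"
    using set_borel_integral_eq_integral(2)[OF 1] hi'[OF assms(2)] by (simp add: integral_unique)
qed

section \<open>The Mellin transform of an exponential series\<close>

text \<open>
  The norms of the terms integrate to \<open>Gamma (Re s)\<close> times the terms of the Dirichlet series at
  \<open>Re s\<close>, so absolute convergence of the latter justifies integrating term by term.
\<close>

lemma mellin_transform_dirichlet:
  fixes b :: "nat \<Rightarrow> real" and s :: complex
  assumes b: "\<And>n. b n \<ge> 0" and s: "Re s > 0"
    and abel: "\<And>t. t > 0 \<Longrightarrow> summable (\<lambda>n. b n * exp (- (real (Suc n) * t)))"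
    and dir: "summable (\<lambda>n. b n * real (Suc n) powr (- Re s))"
  defines "g \<equiv> \<lambda>t. \<Sum>n. b n * exp (- (real (Suc n) * t))"
  shows "set_integrable lborel {0<..} (\<lambda>t. of_real t powr (s - 1) * complex_of_real (g t))"
    and "(\<lambda>n. Gamma s * (of_real (b n) * of_nat (Suc n) powr (- s))) sums
           (LINT t:{0<..}|lborel. of_real t powr (s - 1) * complex_of_real (g t))"
proof -
  define h where "h n t = of_real t powr (s - 1) * complex_of_real (exp (- (real (Suc n) * t)))" for n t
  define f where "f n t = of_real (b n) * h n t" for n t
  have h1: "set_integrable lborel {0<..} (h n)" for n
    using Gamma_integral_scaled(1)[OF _ s, of "real (Suc n)"] unfolding h_def[abs_def] by simp
  have h2: "(LINT t:{0<..}|lborel. h n t) = Gamma s * of_nat (Suc n) powr (- s)" for n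
    using Gamma_integral_scaled(2)[OF _ s, of "real (Suc n)"] unfolding h_def[abs_def] by simp
  have h3: "(LINT t:{0<..}|lborel. norm (h n t)) = Gamma (Re s) * real (Suc n) powr (- Re s)" for n
    using set_integral_norm_powr_exp[OF _ s, of "real (Suc n)"] unfolding h_def[abs_def] by simp
  have f1: "set_integrable lborel {0<..} (f n)" for n
    using h1 unfolding f_def[abs_def] by auto
  have f2: "(LINT t:{0<..}|lborel. f n t) = Gamma s * (of_real (b n) * of_nat (Suc n) powr (- s))" for n
    by (simp add: f_def h2 mult_ac)
  have f3: "(LINT t:{0<..}|lborel. norm (f n t))
      = Gamma (Re s) * (b n * real (Suc n) powr (- Re s))" for n
    using b[of n] by (simp add: f_def norm_mult h3 mult_ac)
  have f4: "f n t = of_real t powr (s - 1) * of_real (b n * exp (- (real (Suc n) * t)))" for n t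
    by (simp add: f_def h_def mult_ac)
  have f5: "(\<Sum>n. f n t) = of_real t powr (s - 1) * of_real (g t)" if "t > 0" for t
    unfolding f4 g_def suminf_of_real[OF abel[OF that]]
    by (rule suminf_mult) (rule summable_of_real[OF abel[OF that]])
  have f6: "summable (\<lambda>n. norm (f n t))" if "t > 0" for t
    using summable_mult[OF abel[OF that], of "norm (of_real t powr (s - 1))"] b
    by (simp add: f4 norm_mult)
  have f7: "summable (\<lambda>n. LINT t:{0<..}|lborel. norm (f n t))"
    unfolding f3 by (rule summable_mult[OF dir])
  have "set_integrable lborel {0<..} (\<lambda>t. \<Sum>n. f n t)"
    by (rule set_sums_integral) (use f1 f6 f7 in auto)
  then show "set_integrable lborel {0<..} (\<lambda>t. of_real t powr (s - 1) * complex_of_real (g t))"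
    by (rule set_integrable_cong[THEN iffD1, rotated 3]) (auto simp: f5)
  have "(\<lambda>n. LINT t:{0<..}|lborel. f n t) sums (LINT t:{0<..}|lborel. (\<Sum>n. f n t))"
    by (rule set_sums_integral) (use f1 f6 f7 in auto)
  moreover have "(LINT t:{0<..}|lborel. (\<Sum>n. f n t))
      = (LINT t:{0<..}|lborel. of_real t powr (s - 1) * of_real (g t))"
    by (rule set_lebesgue_integral_cong) (auto simp: f5)
  ultimately show "(\<lambda>n. Gamma s * (of_real (b n) * of_nat (Suc n) powr (- s))) sums
           (LINT t:{0<..}|lborel. of_real t powr (s - 1) * complex_of_real (g t))"
    by (simp only: f2)
qed

text \<open>
  The contribution of \<open>{0<..d}\<close>: near \<open>0\<close> the integrand is replaced by its Laurent expansion, and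
  each power is integrated explicitly. The factor \<open>1 / (s - r + j)\<close> makes sense for every \<open>s\<close>
  outside a discrete set; this is where the continuation comes from.
\<close>

lemma mellin_near_0:
  fixes c :: "nat \<Rightarrow> complex" and d :: real and r :: nat
  assumes d: "d > 0" and c: "summable (\<lambda>j. norm (c j) * d ^ j)" and s: "Re s > real r"
  shows "(\<lambda>j. of_real d powr (s - of_nat r) * (c j * of_real d ^ j / (s - of_nat r + of_nat j))) sums
           (LINT t:{0<..d}|lborel. of_real t powr (s - 1)
               * ((\<Sum>j. c j * of_real t ^ j) / of_real t ^ r))"
proof -
  define w where "w j = s - of_nat r + of_nat j" for j
  have w: "Re (w j) \<ge> Re s - real r" for j by (simp add: w_def)
  have w0: "Re (w j) > 0" for j using w[of j] s by linarith
  define f where "f j t = c j * complex_of_real t powr (w j - 1)" for j t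
  have f1: "set_integrable lborel {0<..d} (f j)" for j
    using powr_integral_from_0(1)[OF d w0[of j]] unfolding f_def[abs_def] by auto
  have f2: "(LINT t:{0<..d}|lborel. f j t)
      = of_real d powr (s - of_nat r) * (c j * of_real d ^ j / w j)" for j
  proof -
    have "of_real d powr w j = of_real d powr (s - of_nat r) * complex_of_real d ^ j"
      using d by (simp add: w_def powr_add powr_nat)
    then show ?thesis by (simp add: f_def powr_integral_from_0(2)[OF d w0])
  qed
  have f3: "(LINT t:{0<..d}|lborel. norm (f j t))
      = norm (c j) * (d powr (Re s - real r) * d ^ j / Re (w j))" for j
  proof -
    have "complex_of_real (LINT t:{0<..d}|lborel. norm (f j t))
        = (LINT t:{0<..d}|lborel. of_real (norm (f j t)))"
      by (simp add: set_integral_complex_of_real)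
    also have "\<dots> = (LINT t:{0<..d}|lborel. of_real (norm (c j)) * of_real t powr (of_real (Re (w j)) - 1))"
      by (rule set_lebesgue_integral_cong)
          (auto simp: f_def norm_mult norm_of_real_powr powr_of_real[symmetric])
    also have "\<dots> = of_real (norm (c j)) * (of_real d powr of_real (Re (w j)) / of_real (Re (w j)))"
      using powr_integral_from_0(2)[OF d, of "of_real (Re (w j))"] w0[of j] by simp
    also have "\<dots> = of_real (norm (c j) * (d powr Re (w j) / Re (w j)))"
      using d by (simp add: powr_of_real[symmetric])
    also have "d powr Re (w j) = d powr (Re s - real r) * d ^ j"
      using d by (simp add: w_def powr_add powr_realpow)
    finally show ?thesis by (simp only: of_real_eq_iff)
  qed
  have f4: "f j t = of_real t powr (s - 1) / of_real t ^ r * (c j * of_real t ^ j)" if "t > 0" for j t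
  proof -
    have "w j - 1 = s - 1 - of_nat r + of_nat j" by (simp add: w_def)
    then have "complex_of_real t powr (w j - 1)
        = of_real t powr (s - 1) / of_real t ^ r * of_real t ^ j"
      using that by (simp add: powr_add powr_diff powr_nat)
    then show ?thesis by (simp add: f_def)
  qed
  have csum: "summable (\<lambda>j. norm (c j * of_real t ^ j))" if "t \<in> {0<..d}" for t
    by (rule summable_comparison_test'[OF c, of 0])
       (use that in \<open>auto simp: norm_mult norm_power intro!: mult_left_mono power_mono\<close>)
  have f5: "(\<Sum>j. f j t) = of_real t powr (s - 1) * ((\<Sum>j. c j * of_real t ^ j) / of_real t ^ r)"
      if "t \<in> {0<..d}" for t
    using suminf_mult[OF summable_norm_cancel[OF csum[OF that]], of "of_real t powr (s - 1) / of_real t ^ r"] that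
    by (simp add: f4)
  have f6: "summable (\<lambda>j. norm (f j t))" if "t \<in> {0<..d}" for t
    using summable_mult[OF csum[OF that], of "norm (of_real t powr (s - 1) / complex_of_real t ^ r)"] that
    by (simp add: f4 norm_mult norm_divide)
  have f7: "summable (\<lambda>j. LINT t:{0<..d}|lborel. norm (f j t))"
  proof (rule summable_comparison_test'[OF summable_mult[OF c, of "d powr (Re s - real r) / (Re s - real r)"], of 0])
    fix j :: nat
    have "norm (c j) * d ^ j * d powr (Re s - real r) / Re (w j)
        \<le> norm (c j) * d ^ j * d powr (Re s - real r) / (Re s - real r)"
      using w[of j] s d by (intro divide_left_mono mult_pos_pos) auto
    then show "norm (LINT t:{0<..d}|lborel. norm (f j t))
        \<le> d powr (Re s - real r) / (Re s - real r) * (norm (c j) * d ^ j)"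
      using w0[of j] d unfolding f3 by (simp add: mult_ac)
  qed
  have "(\<lambda>j. LINT t:{0<..d}|lborel. f j t) sums (LINT t:{0<..d}|lborel. (\<Sum>j. f j t))"
    by (rule set_sums_integral) (use f1 f6 f7 in auto)
  moreover have "(LINT t:{0<..d}|lborel. (\<Sum>j. f j t))
      = (LINT t:{0<..d}|lborel. of_real t powr (s - 1) * ((\<Sum>j. c j * of_real t ^ j) / of_real t ^ r))"
    by (rule set_lebesgue_integral_cong) (auto simp: f5)
  ultimately show ?thesis by (simp only: f2 w_def)
qed

text \<open>
  Expanding \<open>t powr (s - 1) = exp ((s - 1) * ln t)\<close> into its exponential series and integrating
  term by term exhibits the integral as a power series in \<open>s - 1\<close> that converges everywhere. The
  interchange is dominated by \<open>exp (R * \<bar>ln t\<bar>)\<close> with \<open>R = norm (s - 1)\<close>, which for \<open>t > d\<close> is at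
  most a constant times \<open>t powr R\<close>.
\<close>

lemma holomorphic_mellin_away_from_0:
  fixes g :: "real \<Rightarrow> real" and d :: real
  assumes d: "d > 0" and g: "\<And>t. t > d \<Longrightarrow> g t \<ge> 0"
    and int: "\<And>R. set_integrable lborel {d<..} (\<lambda>t. t powr R * g t)"
  shows "(\<lambda>s. LINT t:{d<..}|lborel. of_real t powr (s - 1) * complex_of_real (g t)) holomorphic_on UNIV"
proof -
  define E where "E s = (LINT t:{d<..}|lborel. of_real t powr (s - 1) * complex_of_real (g t))" for s
  define a where "a k = (LINT t:{d<..}|lborel. complex_of_real (ln t ^ k / fact k * g t))" for k
  have gmeas: "(\<lambda>t. indicator {d<..} t * g t) \<in> borel_measurable lborel"
  proof -
    have "(\<lambda>t. indicator {d<..} t * (t powr 0 * g t)) \<in> borel_measurable lborel"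
      using int[of 0] by (auto simp: set_integrable_def)
    also have "(\<lambda>t. indicator {d<..} t * (t powr 0 * g t)) = (\<lambda>t. indicator {d<..} t * g t)"
      using d by (auto simp: fun_eq_iff indicator_def)
    finally show ?thesis .
  qed
  have dom: "set_integrable lborel {d<..} (\<lambda>t. exp (R * \<bar>ln t\<bar>) * g t)" if R: "R \<ge> 0" for R
  proof (rule set_integrable_bound)
    show "set_integrable lborel {d<..} (\<lambda>t. exp (2 * R * \<bar>ln d\<bar>) * (t powr R * g t))"
      using int[of R] by auto
    have "(\<lambda>t. exp (R * \<bar>ln t\<bar>) * (indicator {d<..} t * g t)) \<in> borel_measurable lborel"
      using gmeas by measurable
    then show "set_borel_measurable lborel {d<..} (\<lambda>t. exp (R * \<bar>ln t\<bar>) * g t)"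
      by (simp add: set_borel_measurable_def mult_ac)
    have "norm (exp (R * \<bar>ln t\<bar>) * g t)
        \<le> norm (exp (2 * R * \<bar>ln d\<bar>) * (t powr R * g t))" if t: "t > d" for t
    proof -
      \<comment> \<open>\<open>\<bar>ln t\<bar>\<close> differs from \<open>ln t\<close> only for \<open>d < t < 1\<close>, and there by at most \<open>2 * \<bar>ln d\<bar>\<close>.\<close>
      have "ln t \<ge> ln d" using t d by simp
      then have "\<bar>ln t\<bar> \<le> 2 * \<bar>ln d\<bar> + ln t" by linarith
      then have "R * \<bar>ln t\<bar> \<le> 2 * R * \<bar>ln d\<bar> + R * ln t"
        using mult_left_mono[OF _ R] by (fastforce simp: algebra_simps)
      then have "exp (R * \<bar>ln t\<bar>) \<le> exp (2 * R * \<bar>ln d\<bar>) * t powr R"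
        using t d by (simp add: powr_def flip: exp_add)
      from mult_right_mono[OF this g[OF t]] show ?thesis
        using g[OF t] by (simp add: abs_mult mult_ac)
    qed
    then show "AE t in lborel. t \<in> {d<..} \<longrightarrow> norm (exp (R * \<bar>ln t\<bar>) * g t)
        \<le> norm (exp (2 * R * \<bar>ln d\<bar>) * (t powr R * g t))"
      by auto
  qed
  have sums: "(\<lambda>k. a k * (s - 1) ^ k) sums E s" for s
  proof -
    define f where "f k t = (s - 1) ^ k * complex_of_real (ln t ^ k / fact k * g t)" for k t
    define R where "R = norm (s - 1)"
    have R: "R \<ge> 0" by (simp add: R_def)
    have nf: "norm (f k t) = (R * \<bar>ln t\<bar>) ^ k / fact k * g t" if "t > d" for k t
      using g[OF that] unfolding f_def norm_mult norm_power R_def norm_of_real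
      by (simp add: abs_mult power_abs power_mult_distrib)
    have es: "(\<lambda>k. x ^ k / fact k) sums exp x" for x :: real
      using exp_converges[of x] by (simp add: divide_inverse mult.commute)
    have part: "(\<Sum>k<N. norm (f k t)) \<le> exp (R * \<bar>ln t\<bar>) * g t" if "t > d" for N t
    proof -
      have "(\<Sum>k<N. (R * \<bar>ln t\<bar>) ^ k / fact k) \<le> exp (R * \<bar>ln t\<bar>)"
        using sum_le_suminf[OF sums_summable[OF es], of "{..<N}" "R * \<bar>ln t\<bar>"] R
        by (simp add: sums_unique[OF es, symmetric])
      from mult_right_mono[OF this g[OF that]] show ?thesis
        by (simp add: nf[OF that] sum_distrib_right)
    qed
    have fint: "set_integrable lborel {d<..} (f k)" for k
    proof (rule set_integrable_bound[OF dom[OF R]])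
      have "(\<lambda>t. (s - 1) ^ k * complex_of_real (ln t ^ k / fact k * (indicator {d<..} t * g t)))
          \<in> borel_measurable lborel"
        using gmeas by measurable
      also have "(\<lambda>t. (s - 1) ^ k * complex_of_real (ln t ^ k / fact k * (indicator {d<..} t * g t)))
          = (\<lambda>t. indicator {d<..} t *\<^sub>R f k t)"
        by (auto simp: fun_eq_iff f_def indicator_def)
      finally show "set_borel_measurable lborel {d<..} (f k)"
        by (simp add: set_borel_measurable_def)
      have "norm (f k t) \<le> norm (exp (R * \<bar>ln t\<bar>) * g t)" if t: "t > d" for t
      proof -
        have "norm (f k t) \<le> (\<Sum>j<Suc k. norm (f j t))"
          by (rule member_le_sum) auto
        also note part[OF t]
        finally show ?thesis by simp
      qed
      then show "AE t in lborel. t \<in> {d<..} \<longrightarrow> norm (f k t) \<le> norm (exp (R * \<bar>ln t\<bar>) * g t)"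
        by auto
    qed
    have s1: "summable (\<lambda>k. norm (f k t))" if "t \<in> {d<..}" for t
      using summable_mult2[OF sums_summable[OF es], of "R * \<bar>ln t\<bar>" "g t"] that by (simp add: nf)
    have s2: "summable (\<lambda>k. LINT t:{d<..}|lborel. norm (f k t))"
    proof (rule bounded_imp_summable)
      show "0 \<le> (LINT t:{d<..}|lborel. norm (f k t))" for k
        unfolding set_lebesgue_integral_def by (rule integral_nonneg_AE) auto
      fix N
      have "(\<Sum>k\<le>N. LINT t:{d<..}|lborel. norm (f k t)) = (LINT t:{d<..}|lborel. (\<Sum>k\<le>N. norm (f k t)))"
        unfolding set_lebesgue_integral_def scaleR_sum_right
        by (rule Bochner_Integration.integral_sum[symmetric])
           (use set_integrable_norm[OF fint] in \<open>auto simp: set_integrable_def\<close>)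
      also have "\<dots> \<le> (LINT t:{d<..}|lborel. exp (R * \<bar>ln t\<bar>) * g t)"
      proof (rule set_integral_mono[OF _ dom[OF R]])
        show "set_integrable lborel {d<..} (\<lambda>t. \<Sum>k\<le>N. norm (f k t))"
          unfolding set_integrable_def scaleR_sum_right
          by (rule Bochner_Integration.integrable_sum)
             (use set_integrable_norm[OF fint] in \<open>auto simp: set_integrable_def\<close>)
        show "(\<Sum>k\<le>N. norm (f k t)) \<le> exp (R * \<bar>ln t\<bar>) * g t" if "t \<in> {d<..}" for t
          using part[of t "Suc N"] that by (simp add: lessThan_Suc_atMost)
      qed
      finally show "(\<Sum>k\<le>N. LINT t:{d<..}|lborel. norm (f k t))
          \<le> (LINT t:{d<..}|lborel. exp (R * \<bar>ln t\<bar>) * g t)" .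
    qed
    have "(\<lambda>k. LINT t:{d<..}|lborel. f k t) sums (LINT t:{d<..}|lborel. (\<Sum>k. f k t))"
      by (rule set_sums_integral) (use fint s1 s2 in auto)
    moreover have "(LINT t:{d<..}|lborel. f k t) = a k * (s - 1) ^ k" for k
      unfolding f_def a_def by (subst set_integral_mult_right) (simp add: mult.commute)
    moreover have "(\<Sum>k. f k t) = of_real t powr (s - 1) * of_real (g t)" if "t \<in> {d<..}" for t
    proof -
      have "(\<lambda>k. ((s - 1) * of_real (ln t)) ^ k /\<^sub>R fact k * of_real (g t))
          sums (exp ((s - 1) * of_real (ln t)) * of_real (g t))"
        by (rule sums_mult2[OF exp_converges])
      moreover have "((s - 1) * of_real (ln t)) ^ k /\<^sub>R fact k * of_real (g t) = f k t" for k
        by (simp only: f_def scaleR_conv_of_real power_mult_distrib)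
           (simp add: divide_inverse mult_ac)
      ultimately have "(\<lambda>k. f k t) sums (exp ((s - 1) * of_real (ln t)) * of_real (g t))" by simp
      moreover have "exp ((s - 1) * of_real (ln t)) = complex_of_real t powr (s - 1)"
        using that d by (simp add: powr_def Ln_of_real)
      ultimately show ?thesis by (simp add: sums_iff)
    qed
    then have "(LINT t:{d<..}|lborel. (\<Sum>k. f k t)) = E s"
      unfolding E_def by (intro set_lebesgue_integral_cong) auto
    ultimately show ?thesis by simp
  qed
  have "E holomorphic_on ball 1 R" for R
    by (rule power_series_holomorphic) (rule sums)
  then have "E holomorphic_on (\<Union>n. ball 1 (real n))"
    by (intro holomorphic_on_UN_open) auto
  moreover have "(\<Union>n. ball (1::complex) (real n)) = UNIV"
    using reals_Archimedean2 by auto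
  ultimately show ?thesis unfolding E_def by simp
qed

section \<open>Series of simple poles\<close>

text \<open>
  All but finitely many of the points \<open>u - j\<close> have distance at least \<open>1\<close> from \<open>w\<close>. For the
  exceptional \<open>w\<close> that equal some \<open>u - j\<close>, the term with index \<open>j\<close> is a division by zero and
  counts as \<open>0\<close>.
\<close>

lemma pole_series_summable:
  fixes e :: "nat \<Rightarrow> complex" and u :: complex
  assumes e: "summable (\<lambda>j. norm (e j))"
  shows "summable (\<lambda>j. e j / (w - u + of_nat j))"
proof -
  obtain N :: nat where N: "real N \<ge> norm (w - u) + 1" using real_arch_simple by blast
  show ?thesis
  proof (rule summable_comparison_test'[OF e])
    fix j assume "j \<ge> N"
    then have "norm (w - u + of_nat j) \<ge> 1"
      using N norm_diff_ineq[of "of_nat j" "w - u"] by (simp add: add.commute)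
    then have "norm (e j) / norm (w - u + of_nat j) \<le> norm (e j) / 1"
      by (intro divide_left_mono) auto
    then show "norm (e j / (w - u + of_nat j)) \<le> norm (e j)" by (simp add: norm_divide)
  qed
qed

text \<open>
  For \<open>w \<in> ball u M\<close> the terms with index above \<open>M\<close> have denominators of norm at least \<open>1\<close>, so the
  tail converges uniformly there by the M-test.
\<close>

lemma pole_series_tail_holomorphic:
  fixes e :: "nat \<Rightarrow> complex" and u :: complex
  assumes e: "summable (\<lambda>j. norm (e j))"
  shows "(\<lambda>w. \<Sum>j. e (j + Suc M) / (w - u + of_nat (j + Suc M))) holomorphic_on ball u (real M)"
proof (rule holomorphic_uniform_sequence)
  have far: "norm (w - u + of_nat (j + Suc M)) \<ge> 1" if "w \<in> ball u (real M)" for w j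
  proof -
    have "norm (w - u) < real M" using that by (simp add: dist_norm norm_minus_commute)
    moreover have "norm (of_nat (j + Suc M) :: complex) = real (j + Suc M)" by (rule norm_of_nat)
    ultimately show ?thesis
      using norm_diff_ineq[of "of_nat (j + Suc M)" "w - u"]
      by (simp only: add.commute[of "of_nat (j + Suc M)" "w - u"])
  qed
  show "(\<lambda>w. \<Sum>j<n. e (j + Suc M) / (w - u + of_nat (j + Suc M))) holomorphic_on ball u (real M)" for n
    by (intro holomorphic_intros) (metis far norm_zero not_one_le_zero)
  fix x assume "x \<in> ball u (real M)"
  then obtain \<rho> where \<rho>: "\<rho> > 0" "cball x \<rho> \<subseteq> ball u (real M)"
    by (meson open_ball open_contains_cball)
  have "uniform_limit (cball x \<rho>) (\<lambda>n w. \<Sum>j<n. e (j + Suc M) / (w - u + of_nat (j + Suc M)))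
          (\<lambda>w. \<Sum>j. e (j + Suc M) / (w - u + of_nat (j + Suc M))) sequentially"
  proof (rule Weierstrass_m_test)
    show "summable (\<lambda>j. norm (e (j + Suc M)))" using e by (rule summable_ignore_initial_segment)
    fix j w assume "w \<in> cball x \<rho>"
    then have "norm (w - u + of_nat (j + Suc M)) \<ge> 1" using far \<rho> by blast
    then have "norm (e (j + Suc M)) / norm (w - u + of_nat (j + Suc M)) \<le> norm (e (j + Suc M)) / 1"
      by (intro divide_left_mono) auto
    then show "norm (e (j + Suc M) / (w - u + of_nat (j + Suc M))) \<le> norm (e (j + Suc M))"
      by (simp add: norm_divide)
  qed
  with \<rho> show "\<exists>d>0. cball x d \<subseteq> ball u (real M)
      \<and> uniform_limit (cball x d) (\<lambda>n w. \<Sum>j<n. e (j + Suc M) / (w - u + of_nat (j + Suc M)))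
          (\<lambda>w. \<Sum>j. e (j + Suc M) / (w - u + of_nat (j + Suc M))) sequentially" by blast
qed auto

lemma pole_series_split:
  fixes e :: "nat \<Rightarrow> complex" and u :: complex
  assumes e: "summable (\<lambda>j. norm (e j))"
  shows "(\<Sum>j. e j / (w - u + of_nat j)) =
    (\<Sum>j\<le>M. e j / (w - u + of_nat j)) + (\<Sum>j. e (j + Suc M) / (w - u + of_nat (j + Suc M)))"
  using suminf_split_initial_segment[OF pole_series_summable[OF e], of w u "Suc M"]
  by (simp add: lessThan_Suc_atMost)

text \<open>
  Near any point, the series is a finite sum of simple fractions plus a holomorphic tail.
\<close>

lemma pole_series_meromorphic:
  fixes e :: "nat \<Rightarrow> complex" and u :: complex
  assumes e: "summable (\<lambda>j. norm (e j))"
  shows "(\<lambda>w. \<Sum>j. e j / (w - u + of_nat j)) meromorphic_on UNIV"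
proof (subst meromorphic_on_meromorphic_at, rule ballI)
  fix z :: complex
  obtain M :: nat where M: "norm (z - u) < real M" using reals_Archimedean2 by blast
  have "(\<lambda>w. \<Sum>j. e (j + Suc M) / (w - u + of_nat (j + Suc M))) analytic_on {z}"
    using pole_series_tail_holomorphic[OF e, where M = M and u = u] M
    by (auto simp: analytic_at dist_norm norm_minus_commute intro!: exI[of _ "ball u (real M)"])
  then show "(\<lambda>w. \<Sum>j. e j / (w - u + of_nat j)) meromorphic_on {z}"
    unfolding pole_series_split[OF e, where M = M]
    by (intro meromorphic_intros analytic_on_imp_meromorphic_on) (auto intro: analytic_intros)
qed

lemma pole_series_principal_part:
  fixes e :: "nat \<Rightarrow> complex" and u :: complex
  assumes e: "summable (\<lambda>j. norm (e j))"
  obtains A where "A analytic_on {u - of_nat k}"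
    "\<And>w. (\<Sum>j. e j / (w - u + of_nat j)) = e k / (w - (u - of_nat k)) + A w"
proof
  let ?T = "\<lambda>w. \<Sum>j. e (j + Suc (Suc k)) / (w - u + of_nat (j + Suc (Suc k)))"
  let ?A = "\<lambda>w. (\<Sum>j\<in>{..Suc k}-{k}. e j / (w - u + of_nat j)) + ?T w"
  have "?T analytic_on {u - of_nat k}"
    using pole_series_tail_holomorphic[OF e, where M = "Suc k" and u = u]
    by (auto simp: analytic_at dist_norm simp del: of_nat_Suc intro!: exI[of _ "ball u (real (Suc k))"])
  then show "?A analytic_on {u - of_nat k}"
    by (intro analytic_intros) (auto simp: algebra_simps)
  fix w
  show "(\<Sum>j. e j / (w - u + of_nat j)) = e k / (w - (u - of_nat k)) + ?A w"
    unfolding pole_series_split[OF e, where M = "Suc k"]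
    by (subst sum.remove[of _ k]) (auto simp: algebra_simps)
qed

lemma pole_series_analytic:
  fixes e :: "nat \<Rightarrow> complex" and u :: complex
  assumes e: "summable (\<lambda>j. norm (e j))" and z: "\<And>j. z - u + of_nat j \<noteq> 0"
  shows "(\<lambda>w. \<Sum>j. e j / (w - u + of_nat j)) analytic_on {z}"
proof -
  obtain M :: nat where M: "norm (z - u) < real M" using reals_Archimedean2 by blast
  have "(\<lambda>w. \<Sum>j. e (j + Suc M) / (w - u + of_nat (j + Suc M))) analytic_on {z}"
    using pole_series_tail_holomorphic[OF e, where M = M and u = u] M
    by (auto simp: analytic_at dist_norm norm_minus_commute intro!: exI[of _ "ball u (real M)"])
  then show ?thesis
    unfolding pole_series_split[OF e, where M = M]
    by (intro analytic_intros) (use z in auto)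
qed

section \<open>Continuation of a Dirichlet series\<close>

text \<open>
  Away from \<open>0\<close>, a smaller exponent costs only a constant factor. Hence integrability against all
  sufficiently large powers, known from the half-plane of convergence, gives it for all powers.
\<close>

lemma power_integrable_away_from_0:
  fixes g :: "real \<Rightarrow> real"
  assumes d: "d > 0"
    and int: "\<And>s. Re s > \<sigma> \<Longrightarrow> set_integrable lborel {0<..} (\<lambda>t. of_real t powr (s - 1) * complex_of_real (g t))"
  shows "set_integrable lborel {d<..} (\<lambda>t. t powr R * g t)"
proof -
  define S where "S = max (R + 1) (\<sigma> + 1)"
  have "set_integrable lborel {0<..} (\<lambda>t. of_real t powr (of_real S - 1) * complex_of_real (g t))"
    by (rule int) (simp add: S_def)
  then have "set_integrable lborel {d<..} (\<lambda>t. of_real t powr (of_real S - 1) * complex_of_real (g t))"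
    by (rule set_integrable_subset) (use d in auto)
  then have "set_integrable lborel {d<..} (\<lambda>t. Re (of_real t powr (of_real S - 1) * complex_of_real (g t)))"
    using integrable_Re unfolding set_integrable_def by fastforce
  also have "?this \<longleftrightarrow> set_integrable lborel {d<..} (\<lambda>t. t powr (S - 1) * g t)"
    by (rule set_integrable_cong) (use d powr_of_real[of _ "S - 1"] in auto)
  finally have 1: "set_integrable lborel {d<..} (\<lambda>t. t powr (S - 1) * g t)" .
  have 2: "t powr R * g t = t powr (R - (S - 1)) * (t powr (S - 1) * g t)" if "t > d" for t
    using that d by (simp flip: powr_add mult.assoc)
  have bnd: "t powr (R - (S - 1)) \<le> d powr (R - (S - 1))" if "t > d" for t
    using that d by (intro powr_mono2') (auto simp: S_def)
  show ?thesis
  proof (rule set_integrable_bound)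
    show "set_integrable lborel {d<..} (\<lambda>t. d powr (R - (S - 1)) * (t powr (S - 1) * g t))"
      using 1 by auto
    have "(\<lambda>t. indicator {d<..} t * (t powr (S - 1) * g t)) \<in> borel_measurable lborel"
      using 1 by (auto simp: set_integrable_def)
    then have "(\<lambda>t. t powr (R - (S - 1)) * (indicator {d<..} t * (t powr (S - 1) * g t)))
        \<in> borel_measurable lborel"
      by measurable
    also have "(\<lambda>t. t powr (R - (S - 1)) * (indicator {d<..} t * (t powr (S - 1) * g t)))
        = (\<lambda>t. indicator {d<..} t *\<^sub>R (t powr R * g t))"
    proof
      fix t show "t powr (R - (S - 1)) * (indicator {d<..} t * (t powr (S - 1) * g t))
          = indicator {d<..} t *\<^sub>R (t powr R * g t)"
      proof (cases "t > d")
        case True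
        show ?thesis unfolding 2[OF True] using True by simp
      qed simp
    qed
    finally show "set_borel_measurable lborel {d<..} (\<lambda>t. t powr R * g t)"
      by (simp add: set_borel_measurable_def)
    show "AE t in lborel. t \<in> {d<..} \<longrightarrow> norm (t powr R * g t)
        \<le> norm (d powr (R - (S - 1)) * (t powr (S - 1) * g t))"
      using bnd d by (auto simp: 2 abs_mult intro!: mult_right_mono)
  qed
qed

text \<open>
  Cutting the Mellin integral at \<open>d\<close> writes \<open>Gamma s\<close> times the Dirichlet series as a series of
  simple poles plus an entire function. The expansion hypothesis says that \<open>c\<^bsub>r-m\<^esub>\<close> is the
  coefficient of \<open>t powr (-m)\<close> in the exponential series; integrating that power produces the pole
  at \<open>s = m\<close>, and dividing by \<open>Gamma m\<close> accounts for the factorial.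
\<close>

lemma dirichlet_series_continuation:
  fixes b :: "nat \<Rightarrow> real" and c :: "nat \<Rightarrow> complex" and d :: real and r :: nat
  assumes b: "\<And>n. b n \<ge> 0"
    and dir: "\<And>x. x > real r \<Longrightarrow> summable (\<lambda>n. b n * real (Suc n) powr (- x))"
    and abel: "\<And>t. t > 0 \<Longrightarrow> summable (\<lambda>n. b n * exp (- (real (Suc n) * t)))"
    and d: "d > 0" and c: "summable (\<lambda>j. norm (c j) * d ^ j)"
    and expansion: "\<And>t. t \<in> {0<..d} \<Longrightarrow>
       complex_of_real (\<Sum>n. b n * exp (- (real (Suc n) * t)))
           = (\<Sum>j. c j * of_real t ^ j) / of_real t ^ r"
  obtains Z where "Z nicely_meromorphic_on UNIV"
    "\<And>s. Re s > real r \<Longrightarrow> (\<lambda>n. of_real (b n) * of_nat (Suc n) powr (- s)) sums Z s"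
    "\<And>m. 1 \<le> m \<Longrightarrow> m \<le> r \<Longrightarrow> residue Z (of_nat m) = c (r - m) / fact (m - 1)"
proof -
  define g where "g t = (\<Sum>n. b n * exp (- (real (Suc n) * t)))" for t
  \<comment> \<open>In \<open>Z0\<close> the two summands continue the Mellin integrals over \<open>t \<le> d\<close> and over \<open>t > d\<close>.\<close>
  define E where "E s = (LINT t:{d<..}|lborel. of_real t powr (s - 1) * complex_of_real (g t))" for s
  define e where "e j = c j * of_real d ^ j" for j
  define K where "K s = (\<Sum>j. e j / (s - of_nat r + of_nat j))" for s
  define Z0 where "Z0 s = rGamma s * (of_real d powr (s - of_nat r) * K s + E s)" for s
  have int: "set_integrable lborel {0<..} (\<lambda>t. of_real t powr (s - 1) * complex_of_real (g t))"
    if "Re s > real r" for s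
    unfolding g_def by (rule mellin_transform_dirichlet(1)[OF b]) (use that dir abel in auto)
  have g0: "g t \<ge> 0" if "t > 0" for t
    unfolding g_def by (rule suminf_nonneg[OF abel[OF that]]) (use b in auto)
  have E: "E holomorphic_on UNIV"
    unfolding E_def using d g0 power_integrable_away_from_0[OF d int]
    by (intro holomorphic_mellin_away_from_0) auto
  have e: "summable (\<lambda>j. norm (e j))"
    using c d by (simp add: e_def norm_mult norm_power)
  have K: "K meromorphic_on UNIV"
    unfolding K_def[abs_def] by (rule pole_series_meromorphic[OF e])
  have Ean: "E analytic_on A" for A
    using E analytic_on_subset analytic_on_open[OF open_UNIV] by blast
  have pow_an: "(\<lambda>s. complex_of_real d powr (s - of_nat r)) analytic_on A" for A
    using d by (intro analytic_intros) auto
  have G_an: "(rGamma :: complex \<Rightarrow> complex) analytic_on A" for A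
    by (intro analytic_intros)
  have Z0_mero: "Z0 meromorphic_on UNIV"
    unfolding Z0_def[abs_def]
    by (intro meromorphic_on_mult meromorphic_on_add K analytic_on_imp_meromorphic_on Ean pow_an G_an)
  have Z0_sums: "(\<lambda>n. of_real (b n) * of_nat (Suc n) powr (- s)) sums Z0 s" if s: "Re s > real r" for s
  proof -
    let ?f = "\<lambda>t. of_real t powr (s - 1) * complex_of_real (g t)"
    have "(\<lambda>j. of_real d powr (s - of_nat r) * (e j / (s - of_nat r + of_nat j))) sums
           (LINT t:{0<..d}|lborel. of_real t powr (s - 1)
               * ((\<Sum>j. c j * of_real t ^ j) / of_real t ^ r))"
      unfolding e_def by (rule mellin_near_0[OF d c s])
    also have "(LINT t:{0<..d}|lborel. of_real t powr (s - 1)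
        * ((\<Sum>j. c j * of_real t ^ j) / of_real t ^ r))
      = (LINT t:{0<..d}|lborel. ?f t)"
      using expansion by (intro set_lebesgue_integral_cong) (auto simp: g_def)
    finally have near: "(\<lambda>j. of_real d powr (s - of_nat r) * (e j / (s - of_nat r + of_nat j))) sums
           (LINT t:{0<..d}|lborel. ?f t)" .
    have "(\<lambda>j. of_real d powr (s - of_nat r) * (e j / (s - of_nat r + of_nat j))) sums
        (of_real d powr (s - of_nat r) * K s)"
      unfolding K_def by (intro sums_mult summable_sums pole_series_summable e)
    then have "of_real d powr (s - of_nat r) * K s = (LINT t:{0<..d}|lborel. ?f t)"
      using near by (rule sums_unique2)
    moreover have "(LINT t:{0<..}|lborel. ?f t) = (LINT t:{0<..d}|lborel. ?f t) + E s"
    proof -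
      have "{0<..} = {0<..d} \<union> {d<..}" using d by auto
      then have "(LINT t:{0<..}|lborel. ?f t) = (LINT t:{0<..d} \<union> {d<..}|lborel. ?f t)" by simp
      also have "\<dots> = (LINT t:{0<..d}|lborel. ?f t) + (LINT t:{d<..}|lborel. ?f t)"
        using d by (intro set_integral_Un set_integrable_subset[OF int[OF s]]) auto
      finally show ?thesis unfolding E_def .
    qed
    moreover have "(\<lambda>n. Gamma s * (of_real (b n) * of_nat (Suc n) powr (- s)))
        sums (LINT t:{0<..}|lborel. ?f t)"
      unfolding g_def by (rule mellin_transform_dirichlet(2)[OF b]) (use s dir abel in auto)
    ultimately have "(\<lambda>n. Gamma s * (of_real (b n) * of_nat (Suc n) powr (- s)))
        sums (of_real d powr (s - of_nat r) * K s + E s)"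
      by simp
    from sums_mult[OF this, of "rGamma s"]
    have "(\<lambda>n. (rGamma s * Gamma s) * (of_real (b n) * of_nat (Suc n) powr (- s))) sums Z0 s"
      by (simp add: Z0_def mult.assoc)
    moreover have "s \<notin> \<int>\<^sub>\<le>\<^sub>0"
      using s by (auto elim!: nonpos_Ints_cases)
    then have "rGamma s * Gamma s = 1"
      by (simp add: rGamma_inverse_Gamma Gamma_eq_zero_iff)
    ultimately show ?thesis by simp
  qed
  have Z0_an: "Z0 analytic_on {s}" if "Re s > real r" for s
  proof -
    have "s - of_nat r + of_nat j \<noteq> 0" for j
      using that by (auto simp: complex_eq_iff)
    then have "K analytic_on {s}"
      unfolding K_def[abs_def] by (intro pole_series_analytic e)
    then show ?thesis
      unfolding Z0_def[abs_def] by (intro analytic_on_mult analytic_on_add Ean pow_an G_an)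
  qed
  have Z0_res: "residue Z0 (of_nat m) = c (r - m) / fact (m - 1)" if m: "1 \<le> m" "m \<le> r" for m
  proof -
    obtain A where A: "A analytic_on {of_nat r - of_nat (r - m)}"
      "\<And>s. K s = e (r - m) / (s - (of_nat r - of_nat (r - m))) + A s"
      unfolding K_def[abs_def] using pole_series_principal_part[OF e] by metis
    have rm: "of_nat r - of_nat (r - m) = (of_nat m :: complex)"
      using m by (simp add: of_nat_diff)
    \<comment> \<open>Clearing the simple pole: \<open>N s = Z0 s * (s - m)\<close> away from \<open>m\<close>, with \<open>N\<close> analytic at \<open>m\<close>.\<close>
    define N where "N s = rGamma s * (of_real d powr (s - of_nat r) * (e (r - m) + A s * (s - of_nat m))
        + E s * (s - of_nat m))" for s
    have "N analytic_on {of_nat m}"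
      unfolding N_def[abs_def] using A(1)[unfolded rm]
      by (intro analytic_on_mult analytic_on_add Ean pow_an G_an analytic_intros)
    then obtain S where S: "open S" "of_nat m \<in> S" "N holomorphic_on S"
      by (auto simp: analytic_at)
    have "residue Z0 (of_nat m) = residue (\<lambda>s. N s / (s - of_nat m)) (of_nat m)"
    proof (rule residue_cong)
      have "Z0 s = N s / (s - of_nat m)" if "s \<noteq> of_nat m" for s
        using that unfolding Z0_def N_def A(2) rm by (simp add: field_simps)
      then show "eventually (\<lambda>s. Z0 s = N s / (s - of_nat m)) (at (of_nat m))"
        by (auto simp: eventually_at_filter)
    qed auto
    also have "\<dots> = N (of_nat m)" by (rule residue_simple[OF S])
    also have "\<dots> = rGamma (of_nat m)
        * (of_real d powr (of_nat m - of_nat r) * of_real d ^ (r - m)) * c (r - m)"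
      by (simp add: N_def e_def)
    also have "of_real d powr (of_nat m - of_nat r) * complex_of_real d ^ (r - m) = 1"
    proof -
      have "of_real d powr (of_nat m - of_nat r) * complex_of_real d ^ (r - m) =
         of_real d powr (of_nat m - of_nat r) * complex_of_real d powr of_nat (r - m)"
        using d by (simp add: powr_nat)
      also have "\<dots> = 1"
        using m d by (simp add: of_nat_diff flip: powr_add)
      finally show ?thesis .
    qed
    also have "rGamma (of_nat m :: complex) = 1 / fact (m - 1)"
      using Gamma_fact[of "m - 1", where 'a = complex] m
      by (simp add: rGamma_inverse_Gamma field_simps)
    finally show ?thesis by simp
  qed
  show ?thesis
  \<comment> \<open>\<open>Z0\<close> need not take the prescribed values at its singularities; \<open>remove_sings\<close> repairs this.\<close>
  proof (rule that[of "remove_sings Z0"])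
    show "remove_sings Z0 nicely_meromorphic_on UNIV"
      by (rule remove_sings_nicely_meromorphic[OF Z0_mero])
    show "(\<lambda>n. of_real (b n) * of_nat (Suc n) powr (- s))
        sums remove_sings Z0 s" if "Re s > real r" for s
      using Z0_sums[OF that] Z0_an[OF that] by (simp add: remove_sings_at_analytic)
    show "residue (remove_sings Z0) (of_nat m) = c (r - m) / fact (m - 1)" if "1 \<le> m" "m \<le> r" for m
      using Z0_res[OF that] meromorphic_on_subset[OF Z0_mero, of "{of_nat m}"]
      by (subst residue_remove_sings) (auto simp: meromorphic_at_iff)
  qed
qed

section \<open>The restricted partition function\<close>

lemma finite_solutions:
  assumes "\<forall>k\<in>set a. k > 0"
  shows "finite {x :: nat list. length x = length a \<and> (\<Sum>i<length a. a ! i * x ! i) = n}"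
proof (rule finite_subset)
  show "{x :: nat list. length x = length a \<and> (\<Sum>i<length a. a ! i * x ! i) = n}
          \<subseteq> {x. set x \<subseteq> {..n} \<and> length x = length a}"
  proof (clarsimp simp: in_set_conv_nth)
    fix x :: "nat list" and j assume x: "length x = length a" "n = (\<Sum>i<length a. a ! i * x ! i)"
        and j: "j < length a"
    have "a ! j > 0" using assms j nth_mem by blast
    then have "x ! j \<le> a ! j * x ! j" by simp
    also have "\<dots> \<le> (\<Sum>i<length a. a ! i * x ! i)" by (rule member_le_sum) (use j in auto)
    finally show "x ! j \<le> (\<Sum>i<length a. a ! i * x ! i)" .
  qed
  show "finite {x. set x \<subseteq> {..n} \<and> length x = length a}" by (rule finite_lists_length_eq) auto
qed

lemma restricted_partition_Nil: "restricted_partition [] n = (if n = 0 then 1 else 0)"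
proof -
  have "{x :: nat list. length x = length [] \<and> (\<Sum>i<length []. [] ! i * x ! i) = n}
      = (if n = 0 then {[]} else {})"
    by auto
  then show ?thesis unfolding restricted_partition_def by simp
qed

text \<open>
  Sort the solutions by the amount \<open>i = k * x\<^sub>0\<close> that the first part contributes. In this form the
  recursion is a Cauchy product, as the generating function requires.
\<close>

lemma restricted_partition_Cons:
  assumes "k > 0" "\<forall>k\<in>set a. k > 0"
  shows "restricted_partition (k # a) n = (\<Sum>i\<le>n. if k dvd i then restricted_partition a (n - i) else 0)"
proof -
  define S where "S a n = {x :: nat list. length x = length a \<and>
      (\<Sum>i<length a. a ! i * x ! i) = n}" for a n
  have "S (k # a) n = (\<Union>i\<in>{i\<in>{..n}. k dvd i}. (#) (i div k) ` S a (n - i))"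
  proof (intro equalityI subsetI)
    fix x assume "x \<in> S (k # a) n"
    then obtain y ys where x: "x = y # ys" "length ys = length a"
        "k * y + (\<Sum>i<length a. a ! i * ys ! i) = n"
      by (cases x) (auto simp: S_def sum.lessThan_Suc_shift simp del: sum.lessThan_Suc)
    then have "x \<in> (#) (k * y div k) ` S a (n - k * y)" "k * y \<in> {i\<in>{..n}. k dvd i}"
      using assms by (auto simp: S_def)
    then show "x \<in> (\<Union>i\<in>{i\<in>{..n}. k dvd i}. (#) (i div k) ` S a (n - i))" by blast
  qed (use assms in \<open>auto simp: S_def sum.lessThan_Suc_shift simp del: sum.lessThan_Suc\<close>)
  then have "card (S (k # a) n) = (\<Sum>i\<in>{i\<in>{..n}. k dvd i}. card ((#) (i div k) ` S a (n - i)))"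
    using finite_solutions[OF assms(2)]
    by (subst card_UN_disjoint[symmetric]) (auto simp: S_def dvd_div_eq_iff)
  also have "\<dots> = (\<Sum>i\<in>{i\<in>{..n}. k dvd i}. card (S a (n - i)))"
    by (intro sum.cong refl card_image) auto
  also have "\<dots> = (\<Sum>i\<le>n. if k dvd i then card (S a (n - i)) else 0)"
    by (subst sum.inter_filter) auto
  finally have "card (S (k # a) n) = (\<Sum>i\<le>n. if k dvd i then card (S a (n - i)) else 0)" .
  moreover have "restricted_partition b j = card (S b j)" for b j
    by (simp only: S_def restricted_partition_def)
  ultimately show ?thesis by (simp only:)
qed

text \<open>
  The exponent \<open>length a - 1\<close>, rather than \<open>length a\<close>, is what gives convergence of the Dirichlet
  series in the whole half-plane \<open>Re s > length a\<close>. It comes from the base case: a single part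
  admits at most one solution.
\<close>

lemma restricted_partition_bound:
  assumes "\<forall>k\<in>set a. k > 0" "a \<noteq> []"
  shows "restricted_partition a n \<le> Suc n ^ (length a - 1)"
  using assms
proof (induction a arbitrary: n)
  case (Cons k a)
  have rec: "restricted_partition (k # a) n
      = (\<Sum>i\<le>n. if k dvd i then restricted_partition a (n - i) else 0)"
    using Cons.prems by (intro restricted_partition_Cons) auto
  show ?case
  proof (cases "a = []")
    case True
    have "(\<Sum>i\<le>n. if k dvd i then restricted_partition a (n - i) else 0)
        \<le> (\<Sum>i\<le>n. if i = n then 1 else 0)"
      by (rule sum_mono) (auto simp: True restricted_partition_Nil)
    then show ?thesis using rec True by simp
  next
    case False
    have "(\<Sum>i\<le>n. if k dvd i then restricted_partition a (n - i) else 0)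
        \<le> (\<Sum>i\<le>n. Suc n ^ (length a - 1))"
    proof (rule sum_mono)
      fix i assume "i \<in> {..n}"
      have "restricted_partition a (n - i) \<le> Suc (n - i) ^ (length a - 1)"
        using Cons False by simp
      also have "\<dots> \<le> Suc n ^ (length a - 1)" by (rule power_mono) auto
      finally show "(if k dvd i then restricted_partition a (n - i) else 0)
          \<le> Suc n ^ (length a - 1)" by simp
    qed
    also have "\<dots> = Suc n ^ length a"
      using False by (cases a) auto
    finally show ?thesis using rec by simp
  qed
qed simp

lemma sums_power_multiples:
  fixes q :: real
  assumes "0 \<le> q" "q < 1" "k > 0"
  shows "(\<lambda>i. if k dvd i then q ^ i else 0) sums (1 / (1 - q ^ k))"
proof -
  have "(\<lambda>i. (q ^ k) ^ i) sums (1 / (1 - q ^ k))"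
    using assms by (intro geometric_sums) (auto simp: power_less_one_iff abs_if)
  then have "(\<lambda>i. (\<lambda>i. if k dvd i then q ^ i else 0) (k * i)) sums (1 / (1 - q ^ k))"
    by (simp add: power_mult)
  then show ?thesis
    by (subst (asm) sums_mono_reindex) (use assms in \<open>auto simp: strict_mono_def\<close>)
qed

lemma restricted_partition_generating_function:
  fixes q :: real
  assumes "0 \<le> q" "q < 1" "\<forall>k\<in>set a. k > 0"
  shows "(\<lambda>n. real (restricted_partition a n) * q ^ n) sums (\<Prod>i<length a. 1 / (1 - q ^ (a ! i)))"
  using assms(3)
proof (induction a)
  case Nil
  have "(\<lambda>n. real (restricted_partition [] n) * q ^ n) = (\<lambda>n. if n = 0 then 1 else 0)"
    by (auto simp: restricted_partition_Nil)
  then show ?case using sums_single[of 0 "\<lambda>_. 1::real"] by simp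
next
  case (Cons k a)
  let ?u = "\<lambda>i. if k dvd i then q ^ i else 0"
  let ?v = "\<lambda>n. real (restricted_partition a n) * q ^ n"
  have u: "?u sums (1 / (1 - q ^ k))" using assms Cons.prems by (intro sums_power_multiples) auto
  have v: "?v sums (\<Prod>i<length a. 1 / (1 - q ^ (a ! i)))" using Cons by simp
  have "(\<lambda>n. \<Sum>i\<le>n. ?u i * ?v (n - i)) sums ((\<Sum>i. ?u i) * (\<Sum>n. ?v n))"
  proof (rule Cauchy_product_sums)
    have "(\<lambda>i. norm (?u i)) = ?u" using assms by auto
    then show "summable (\<lambda>i. norm (?u i))" using u by (simp add: sums_iff)
    have "(\<lambda>n. norm (?v n)) = ?v" using assms by auto
    then show "summable (\<lambda>n. norm (?v n))" using v by (simp add: sums_iff)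
  qed
  moreover have "(\<Sum>i\<le>n. ?u i * ?v (n - i)) = real (restricted_partition (k # a) n) * q ^ n" for n
  proof -
    have "(\<Sum>i\<le>n. ?u i * ?v (n - i))
        = (\<Sum>i\<le>n. real (if k dvd i then restricted_partition a (n - i) else 0) * q ^ n)"
      by (rule sum.cong) (auto simp flip: power_add)
    then show ?thesis
      using Cons.prems by (simp add: restricted_partition_Cons sum_distrib_right)
  qed
  ultimately show ?case
    using u v by (simp add: sums_iff prod.lessThan_Suc_shift del: prod.lessThan_Suc)
qed

section \<open>Bernoulli--Barnes numbers and the zeta function\<close>

text \<open>
  The formal quotient defining the Bernoulli--Barnes numbers is the Taylor expansion of the
  function \<open>z^r / (\<Prod>i. (exp (a\<^sub>i z) - 1))\<close> with its removable singularity at \<open>0\<close> filled in. It is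
  evaluated at \<open>z = -t\<close>, where each factor \<open>z / (exp (a\<^sub>i z) - 1)\<close> equals
  \<open>t / (1 - exp (-a\<^sub>i t))\<close>; this is the source of the sign \<open>(-1)^j\<close>.
\<close>

lemma bernoulli_barnes_expansion:
  assumes "\<forall>i<length a. a ! i > 0"
  obtains d :: real where "d > 0" "summable (\<lambda>j. norm (bernoulli_barnes a j / fact j) * d ^ j)"
    "\<And>t. t \<in> {0<..d} \<Longrightarrow> (\<lambda>j. (- 1) ^ j * bernoulli_barnes a j / fact j * of_real t ^ j) sums
        (of_real t ^ length a * of_real (\<Prod>i<length a. 1 / (1 - exp (- t) ^ (a ! i))))"
proof -
  let ?D = "\<Prod>i<length a. fps_exp (of_nat (a ! i)) - 1 :: complex fps"
  let ?F = "fps_X ^ length a / ?D :: complex fps"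
  let ?g = "\<lambda>z. \<Prod>i<length a. exp (of_nat (a ! i) * z) - 1 :: complex"
  have sub: "subdegree (fps_exp (of_nat k) - 1 :: complex fps) = 1" if "k > 0" for k :: nat
    by (rule subdegreeI) (use that in auto)
  have nz: "fps_exp (of_nat (a ! i)) - 1 \<noteq> (0 :: complex fps)" if "i < length a" for i
    using sub[of "a ! i"] assms that by force
  have "subdegree ?D = (\<Sum>i<length a. subdegree (fps_exp (of_nat (a ! i)) - 1 :: complex fps))"
    by (rule subdegree_prod) (use nz in auto)
  also have "\<dots> = length a"
    using assms sub by simp
  finally have sD: "subdegree ?D = length a" .
  have D0: "?D \<noteq> 0"
    using nz by simp
  define c where "c = fps_nth (fps_X ^ length a) (subdegree ?D) / fps_nth ?D (subdegree ?D)"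
  define f where "f z = (if z = 0 then c else z ^ length a / ?g z)" for z
  have "f has_fps_expansion ?F"
    unfolding f_def[abs_def]
  proof (rule has_fps_expansion_divide)
    show "?g has_fps_expansion ?D" by (intro fps_expansion_intros)
    show "(\<lambda>z. z ^ length a) has_fps_expansion fps_X ^ length a" by (intro fps_expansion_intros)
  qed (use D0 sD in \<open>auto simp: c_def fps_X_power_subdegree\<close>)
  then have conv: "fps_conv_radius ?F > 0" and ev: "eventually (\<lambda>z. eval_fps ?F z = f z) (nhds 0)"
    by (auto simp: has_fps_expansion_def)
  obtain \<rho> where \<rho>: "\<rho> > 0" "\<And>z. norm z < \<rho> \<Longrightarrow> eval_fps ?F z = f z"
    using ev unfolding eventually_nhds_metric by (auto simp: dist_norm)
  obtain R where R: "R > 0" "ereal R < fps_conv_radius ?F"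
    using conv ereal_dense2[OF conv] by (auto simp: zero_ereal_def)
  define d where "d = min (\<rho> / 2) R"
  have d: "d > 0" "d < \<rho>" "ereal d < fps_conv_radius ?F"
    using \<rho> R le_less_trans[of "ereal d" "ereal R"] by (auto simp: d_def)
  have coeff: "fps_nth ?F j = bernoulli_barnes a j / fact j" for j
    by (simp add: bernoulli_barnes_def)
  show ?thesis
  proof (rule that[OF d(1)])
    have "summable (\<lambda>j. norm (fps_nth ?F j * of_real d ^ j))"
      by (rule norm_summable_fps) (use d in simp)
    then show "summable (\<lambda>j. norm (bernoulli_barnes a j / fact j) * d ^ j)"
      using d unfolding coeff by (simp add: norm_mult norm_power norm_divide)
    fix t assume t: "t \<in> {0<..d}"
    then have t0: "t > 0" by simp
    define z where "z = - complex_of_real t"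
    have nz: "norm z \<le> d" using t by (simp add: z_def)
    have "(\<lambda>j. fps_nth ?F j * z ^ j) sums eval_fps ?F z"
      unfolding eval_fps_def
      by (intro summable_sums summable_fps le_less_trans[OF _ d(3)]) (use nz in simp)
    also have "eval_fps ?F z = f z" using \<rho>(2) nz d by simp
    also have "f z = z ^ length a / ?g z" using t by (simp add: f_def z_def)
    also have "z ^ length a / ?g z = (\<Prod>i<length a. z / (exp (of_nat (a ! i) * z) - 1))"
      by (simp add: prod_dividef)
    also have "\<dots> = (\<Prod>i<length a. of_real t * of_real (1 / (1 - exp (- t) ^ (a ! i))))"
    proof (rule prod.cong)
      fix i assume "i \<in> {..<length a}"
      have "exp (of_nat (a ! i) * z) = of_real (exp (- t) ^ (a ! i))"
        using exp_of_real[of "- t", where 'a = complex]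
            by (simp only: exp_of_nat_mult z_def of_real_minus of_real_power)
      moreover have "exp (- t) ^ (a ! i) < 1"
        using t0 assms \<open>i \<in> _\<close> by (auto simp: power_less_one_iff)
      ultimately show "z / (exp (of_nat (a ! i) * z) - 1)
          = of_real t * of_real (1 / (1 - exp (- t) ^ (a ! i)))"
        using minus_divide_divide[of "complex_of_real t" "1 - complex_of_real (exp (- t) ^ (a ! i))"]
        by (simp only: z_def minus_diff_eq) simp
    qed auto
    also have "\<dots> = of_real t ^ length a * of_real (\<Prod>i<length a. 1 / (1 - exp (- t) ^ (a ! i)))"
      by (simp only: prod.distrib of_real_prod) simp
    finally have "(\<lambda>j. fps_nth ?F j * z ^ j) sums
        (of_real t ^ length a * of_real (\<Prod>i<length a. 1 / (1 - exp (- t) ^ (a ! i))))" .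
    moreover have "fps_nth ?F j * z ^ j
        = (- 1) ^ j * bernoulli_barnes a j / fact j * of_real t ^ j" for j
    proof -
      have "z ^ j = (- 1) ^ j * of_real t ^ j" unfolding z_def by (rule power_minus)
      then show ?thesis unfolding coeff by simp
    qed
    ultimately show "(\<lambda>j. (- 1) ^ j * bernoulli_barnes a j / fact j * of_real t ^ j) sums
        (of_real t ^ length a * of_real (\<Prod>i<length a. 1 / (1 - exp (- t) ^ (a ! i))))" by (simp only:)
  qed
qed

text \<open>
  By the identity theorem, the difference of two continuations vanishes outside a discrete set.
\<close>

lemma is_barnes_zeta_residue_unique:
  assumes "is_barnes_zeta a Y" "is_barnes_zeta a Z"
  shows "residue Y s = residue Z s"
proof -
  let ?D = "\<lambda>s. Y s - Z s"
  let ?H = "{s. Re s > real (length a)}"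
  have mero: "Y meromorphic_on UNIV" "Z meromorphic_on UNIV"
    using assms by (auto simp: is_barnes_zeta_def nicely_meromorphic_on_def)
  then have D: "?D meromorphic_on UNIV" by (intro meromorphic_intros)
  have zero: "Y s = Z s" if "s \<in> ?H" for s
    using assms that sums_unique2 unfolding is_barnes_zeta_def by blast
  have "eventually (\<lambda>s. ?D s = 0) (cosparse UNIV)"
  proof (rule ccontr)
    assume "\<not> ?thesis"
    then have "eventually (\<lambda>s. ?D s \<noteq> 0) (cosparse UNIV)"
      using meromorphic_imp_constant_or_avoid[OF D, of 0] by auto
    then have "eventually (\<lambda>s. ?D s \<noteq> 0) (at (of_nat (Suc (length a))))"
      by (simp add: eventually_cosparse_open_eq)
    moreover have "eventually (\<lambda>s. s \<in> ?H) (at (of_nat (Suc (length a))))"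
      by (rule eventually_at_in_open') (auto simp: open_halfspace_Re_gt)
    ultimately have "eventually (\<lambda>s :: complex. False) (at (of_nat (Suc (length a))))"
      by eventually_elim (use zero in auto)
    then show False by simp
  qed
  then have "eventually (\<lambda>s. Y s = Z s) (at s)"
    by (simp add: eventually_cosparse_open_eq)
  then show ?thesis by (rule residue_cong) simp
qed

lemma restricted_partition_dirichlet_summable:
  assumes "\<forall>k\<in>set a. k > 0" "a \<noteq> []" "x > real (length a)"
  shows "summable (\<lambda>n. real (restricted_partition a (Suc n)) * real (Suc n) powr (- x))"
proof -
  define k where "k = length a - 1"
  have k: "real (length a) = real k + 1" using assms(2) by (cases a) (auto simp: k_def)
  have "summable (\<lambda>n. real n powr (real k - x))"
    using assms(3) k by (simp add: summable_real_powr_iff)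
  then have "summable (\<lambda>n. 2 ^ k * real (Suc n) powr (real k - x))"
    by (intro summable_mult) (subst summable_Suc_iff)
  then show ?thesis
  proof (rule summable_comparison_test'[where N = 0])
    fix n
    have "real (restricted_partition a (Suc n)) \<le> real (Suc (Suc n) ^ k)"
      using restricted_partition_bound[OF assms(1,2), of "Suc n"] unfolding k_def by (rule of_nat_mono)
    also have "\<dots> = real (Suc (Suc n)) ^ k" by simp
    also have "\<dots> \<le> (2 * real (Suc n)) ^ k" by (rule power_mono) auto
    also have "\<dots> = 2 ^ k * real (Suc n) powr real k"
      unfolding power_mult_distrib by (simp add: powr_realpow)
    finally have "real (restricted_partition a (Suc n)) * real (Suc n) powr (- x)
        \<le> 2 ^ k * real (Suc n) powr real k * real (Suc n) powr (- x)"
      by (rule mult_right_mono) simp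
    also have "\<dots> = 2 ^ k * real (Suc n) powr (real k - x)"
      by (simp only: mult.assoc powr_add[symmetric]) simp
    finally show "norm (real (restricted_partition a (Suc n)) * real (Suc n) powr (- x))
        \<le> 2 ^ k * real (Suc n) powr (real k - x)"
      by simp
  qed
qed

lemma restricted_partition_0:
  assumes "\<forall>k\<in>set a. k > 0"
  shows "restricted_partition a 0 = 1"
  using assms by (induction a) (auto simp: restricted_partition_Nil restricted_partition_Cons)

text \<open>
  The general continuation theorem applied to the restricted partition function. The correction at
  \<open>j = r\<close> does not reach the residues, since \<open>m \<ge> 1\<close> means that only \<open>j = r - m < r\<close> occur.
\<close>

lemma is_barnes_zeta_exists:
  assumes "\<forall>i<length a. a ! i > 0" "a \<noteq> []"
  obtains Z where "is_barnes_zeta a Z"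
    "\<And>m. 1 \<le> m \<Longrightarrow> m \<le> length a \<Longrightarrow> residue Z (of_nat m) =
      (- 1) ^ (length a - m) / (fact (m - 1) * fact (length a - m)) * bernoulli_barnes a (length a - m)"
proof -
  let ?r = "length a"
  have pos: "\<forall>k\<in>set a. k > 0" using assms(1) by (simp add: all_set_conv_all_nth)
  obtain d :: real where d: "d > 0" "summable (\<lambda>j. norm (bernoulli_barnes a j / fact j) * d ^ j)"
    "\<And>t. t \<in> {0<..d} \<Longrightarrow> (\<lambda>j. (- 1) ^ j * bernoulli_barnes a j / fact j * of_real t ^ j) sums
        (of_real t ^ ?r * of_real (\<Prod>i<?r. 1 / (1 - exp (- t) ^ (a ! i))))"
    using bernoulli_barnes_expansion[OF assms(1)] by blast
  \<comment> \<open>The Dirichlet series starts at \<open>n = 1\<close>, so the constant \<open>1 = t^r / t^r\<close> is subtracted.\<close>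
  define c where "c j = (- 1) ^ j * bernoulli_barnes a j / fact j - (if j = ?r then 1 else 0)" for j
  define b where "b n = real (restricted_partition a (Suc n))" for n
  have gf: "(\<lambda>n. b n * exp (- (real (Suc n) * t))) sums ((\<Prod>i<?r. 1 / (1 - exp (- t) ^ (a ! i))) - 1)"
    if "t > 0" for t
  proof -
    have "(\<lambda>n. real (restricted_partition a n) * exp (- t) ^ n)
        sums (\<Prod>i<?r. 1 / (1 - exp (- t) ^ (a ! i)))"
      by (rule restricted_partition_generating_function) (use that pos in auto)
    then have "(\<lambda>n. b n * exp (- t) ^ Suc n) sums ((\<Prod>i<?r. 1 / (1 - exp (- t) ^ (a ! i))) - 1)"
      unfolding b_def by (subst sums_Suc_iff) (simp add: restricted_partition_0[OF pos])
    moreover have "exp (- t) ^ Suc n = exp (- (real (Suc n) * t))" for n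
      using exp_of_nat_mult[of "Suc n" "- t"] by simp
    ultimately show ?thesis by (simp only:)
  qed
  obtain Z where Z: "Z nicely_meromorphic_on UNIV"
    "\<And>s. Re s > real ?r \<Longrightarrow> (\<lambda>n. of_real (b n) * of_nat (Suc n) powr (- s)) sums Z s"
    "\<And>m. 1 \<le> m \<Longrightarrow> m \<le> ?r \<Longrightarrow> residue Z (of_nat m) = c (?r - m) / fact (m - 1)"
  proof (rule dirichlet_series_continuation[of b ?r d c])
    show "summable (\<lambda>n. b n * real (Suc n) powr (- x))" if "x > real ?r" for x
      unfolding b_def by (rule restricted_partition_dirichlet_summable[OF pos assms(2) that])
    show "summable (\<lambda>n. b n * exp (- (real (Suc n) * t)))" if "t > 0" for t
      using gf[OF that] by (rule sums_summable)
    show "summable (\<lambda>j. norm (c j) * d ^ j)"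
    proof (rule summable_comparison_test'[where N = "Suc ?r"])
      show "summable (\<lambda>j. norm (bernoulli_barnes a j / fact j) * d ^ j)" by fact
      show "norm (norm (c j) * d ^ j) \<le> norm (bernoulli_barnes a j / fact j) * d ^ j"
          if "j \<ge> Suc ?r" for j
        using that d(1) by (simp add: c_def norm_mult norm_divide norm_power)
    qed
    show "complex_of_real (\<Sum>n. b n * exp (- (real (Suc n) * t)))
        = (\<Sum>j. c j * of_real t ^ j) / of_real t ^ ?r"
      if t: "t \<in> {0<..d}" for t
    proof -
      let ?P = "\<Prod>i<?r. 1 / (1 - exp (- t) ^ (a ! i))"
      have "(\<lambda>j. if j = ?r then complex_of_real t ^ j else 0) sums of_real t ^ ?r"
        by (rule sums_single)
      from sums_diff[OF d(3)[OF t] this]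
      have "(\<lambda>j. c j * of_real t ^ j) sums (of_real t ^ ?r * of_real ?P - of_real t ^ ?r)"
        by (rule sums_cong[THEN iffD1, rotated]) (simp add: c_def algebra_simps)
      then have "(\<Sum>j. c j * of_real t ^ j) = of_real t ^ ?r * of_real (?P - 1)"
        by (simp add: sums_iff algebra_simps)
      moreover have "(\<Sum>n. b n * exp (- (real (Suc n) * t))) = ?P - 1"
        using gf[of t] t by (simp add: sums_iff)
      ultimately show ?thesis using t by (simp only:) simp
    qed
  qed (use d in \<open>auto simp: b_def\<close>)
  have "is_barnes_zeta a Z"
    unfolding is_barnes_zeta_def using Z(1,2) by (simp add: b_def)
  moreover have "residue Z (of_nat m)
      = (- 1) ^ (?r - m) / (fact (m - 1) * fact (?r - m)) * bernoulli_barnes a (?r - m)"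
    if "1 \<le> m" "m \<le> ?r" for m
    using Z(3)[OF that] that by (simp add: c_def mult_ac)
  ultimately show ?thesis by (rule that)
qed

theorem theorem2p10:
  fixes a :: "nat list" and r m :: nat
  assumes "r \<ge> 1" and "length a = r" and "\<forall>i<r. a ! i > 0"
    and "1 \<le> m" and "m \<le> r"
  shows "residue (barnes_zeta a) (of_nat m) =
           (- 1) ^ (r - m) / (fact (m - 1) * fact (r - m)) * bernoulli_barnes a (r - m)"
proof -
  obtain Z where Z: "is_barnes_zeta a Z" "residue Z (of_nat m) =
      (- 1) ^ (r - m) / (fact (m - 1) * fact (r - m)) * bernoulli_barnes a (r - m)"
  proof (rule is_barnes_zeta_exists[of a])
    fix Z
    assume "is_barnes_zeta a Z"
      and "\<And>m. 1 \<le> m \<Longrightarrow> m \<le> length a \<Longrightarrow> residue Z (of_nat m) =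
        (- 1) ^ (length a - m) / (fact (m - 1) * fact (length a - m)) * bernoulli_barnes a (length a - m)"
    then show thesis using that[of Z] assms by blast
  qed (use assms in auto)
  have "is_barnes_zeta a (barnes_zeta a)"
    unfolding barnes_zeta_def by (rule someI[of "is_barnes_zeta a"]) (rule Z(1))
  then have "residue (barnes_zeta a) (of_nat m) = residue Z (of_nat m)"
    using Z(1) by (rule is_barnes_zeta_residue_unique)
  with Z(2) show ?thesis by simp
qed

end
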